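(* Let $X$ be a Fréchet topological space, let $Y$ be a Hausdorff topological space, and let $f:X\to Y$ be a compact-preserving function. Then the restriction $f|SI_f$ of $f$ to the subspace $SI_f\subset X$ is continuous.
   Context: A function $f:X\to Y$ between topological spaces (not assumed continuous) is compact-preserving if the image $f(K)$ of each compact subset $K\subset X$ is compact. Compact means that every open cover has a finite subcover (no separation axiom included). A topological space $X$ is Fréchet if for each subset $A\subset X$ and each point $a\in\bar A$ there is a sequence of points of $A$ that converges to $a$. A function $f:X\to Y$ is sequentially infinite at $x\in X$ if there is a sequence $(x_n)_{n\in\omega}$ in $X$ that converges to $x$ and has infinite image $\{f(x_n)\}_{n\in\omega}$. $SI_f$ denotes the set of all points $x\in X$ at which $f$ is sequentially infinite. *)

theory Defs
  imports "HOL-Analysis.Analysis"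
begin

definition compact_preserving :: "'a topology \<Rightarrow> 'b topology \<Rightarrow> ('a \<Rightarrow> 'b) \<Rightarrow> bool" where
  "compact_preserving X Y f \<longleftrightarrow>
     f \<in> topspace X \<rightarrow> topspace Y \<and> (\<forall>K. compactin X K \<longrightarrow> compactin Y (f ` K))"

definition frechet_space :: "'a topology \<Rightarrow> bool" where
  "frechet_space X \<longleftrightarrow>
     (\<forall>A a. A \<subseteq> topspace X \<and> a \<in> X closure_of A \<longrightarrow>
        (\<exists>s :: nat \<Rightarrow> 'a. range s \<subseteq> A \<and> limitin X s a sequentially))"

definition sequentially_infinite_at :: "'a topology \<Rightarrow> ('a \<Rightarrow> 'b) \<Rightarrow> 'a \<Rightarrow> bool" where
  "sequentially_infinite_at X f x \<longleftrightarrow>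
     (\<exists>s :: nat \<Rightarrow> 'a. range s \<subseteq> topspace X \<and> limitin X s x sequentially \<and>
        infinite (f ` range s))"

definition SI :: "'a topology \<Rightarrow> ('a \<Rightarrow> 'b) \<Rightarrow> 'a set" where
  "SI X f = {x \<in> topspace X. sequentially_infinite_at X f x}"

end

theory Submission
  imports Defs
begin

text \<open>
  If \<open>s\<close> converges to \<open>x\<close> and \<open>W\<close> is an open neighbourhood of \<open>f x\<close>, then every subset of
  \<open>D = f ` range s - W\<close> is compact: it is the image of a compact set \<open>insert x S\<close> with
  \<open>S \<subseteq> range s\<close>, minus \<open>W\<close>.  As \<open>Y\<close> is Hausdorff, \<open>D\<close> is compact and discrete, so it is finite.

  If continuity of the restriction fails at \<open>x\<close>, this makes \<open>x\<close> a limit of points \<open>a n\<close> of \<open>SI_f\<close>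
  that have a common value \<open>y \<noteq> f x\<close>.  Each \<open>a n\<close> is a limit of a sequence with infinitely many
  values near \<open>y\<close>.  Thinning these sequences out diagonally gives a set \<open>R\<close> on which every value is
  attained only finitely often and whose closure contains every \<open>a n\<close>, hence \<open>x\<close>.  A sequence in
  \<open>R\<close> that converges to \<open>x\<close> has finitely many values, hence finitely many terms, so \<open>x\<close> lies in the
  closure of a point of \<open>R\<close>.  As \<open>X\<close> need not be T1, such points have to be excluded from \<open>R\<close>
  beforehand; a sequence of them converges to \<open>x\<close>, so they too have only finitely many values.
\<close>

text \<open>For \<open>d\<close> in \<open>D\<close> the compact set \<open>D - {d}\<close> is
  closed in \<open>Y\<close>, which isolates \<open>d\<close> within \<open>D\<close>.\<close>

lemma Hausdorff_finite_if_subsets_compact: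
  assumes "Hausdorff_space Y" and sub: "\<And>E. E \<subseteq> D \<Longrightarrow> compactin Y E"
  shows "finite D"
proof -
  have D: "compactin Y D" using sub by blast
  have "openin (subtopology Y D) {d}" if "d \<in> D" for d
  proof -
    have "closedin Y (D - {d})"
      using assms(1) sub by (simp add: compactin_imp_closedin)
    then have "openin (subtopology Y D) (D \<inter> (topspace Y - (D - {d})))"
      by (simp add: openin_subtopology_Int2 openin_diff)
    moreover have "D \<inter> (topspace Y - (D - {d})) = {d}"
      using that compactin_subset_topspace[OF D] by blast
    ultimately show ?thesis by simp
  qed
  then have "subtopology Y D = discrete_topology D"
    using compactin_subset_topspace[OF D]
    by (metis discrete_topology_unique topspace_subtopology_subset)
  then show ?thesis
    using D by (metis compact_space_discrete_topology compact_space_subtopology)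
qed

lemma compact_preserving_finite_values_outside:
  assumes "Hausdorff_space Y" "compact_preserving X Y f"
    and s: "range s \<subseteq> topspace X" "limitin X s x sequentially"
    and W: "openin Y W" "f x \<in> W"
  shows "finite (f ` range s - W)"
proof (rule Hausdorff_finite_if_subsets_compact[OF assms(1)])
  fix E assume E: "E \<subseteq> f ` range s - W"
  define S where "S = {p \<in> range s. f p \<in> E}"
  have "compactin X (insert x S)"
    using s by (intro compactin_sequence_with_limit[of X s]) (auto simp: S_def)
  then have K: "compactin Y (f ` insert x S)"
    using assms(2) unfolding compact_preserving_def by blast
  \<comment> \<open>The added value \<open>f x\<close> lies in \<open>W\<close>, so removing
    \<open>W\<close> leaves exactly \<open>E\<close>.\<close>
  have "E = (topspace Y - W) \<inter> f ` insert x S"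
    using E W compactin_subset_topspace[OF K] by (auto simp: S_def)
  moreover have "closedin Y (topspace Y - W)" using W by blast
  ultimately show "compactin Y E" using K closed_Int_compactin by metis
qed

text \<open>\<open>S\<close> is a union of finitely many fibres, and closure commutes with finite
  unions.\<close>

lemma closure_of_finite_image:
  assumes "x \<in> X closure_of S" "finite (f ` S)"
  obtains y where "y \<in> f ` S" "x \<in> X closure_of {p \<in> S. f p = y}"
proof -
  have "S = \<Union> ((\<lambda>y. {p \<in> S. f p = y}) ` f ` S)" by blast
  then have "x \<in> X closure_of \<Union> ((\<lambda>y. {p \<in> S. f p = y}) ` f ` S)"
    using assms(1) by simp
  then show thesis
    using that assms(2) by (subst (asm) closure_of_Union) auto
qed

text \<open>The finitely many terms before a given index cannot exhaust \<open>H\<close>, so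
  \<open>H\<close> contains terms from every tail.\<close>

lemma limitin_in_closure_of_infinite_subset:
  fixes s :: "nat \<Rightarrow> 'a"
  assumes "limitin X s a sequentially" "infinite H" "H \<subseteq> range s"
  shows "a \<in> X closure_of H"
  unfolding in_closure_of
proof (intro conjI allI impI)
  show "a \<in> topspace X" using assms(1) by (simp add: limitin_def)
  fix T assume "a \<in> T \<and> openin X T"
  then obtain N where N: "\<And>n. N \<le> n \<Longrightarrow> s n \<in> T"
    using assms(1) unfolding limitin_sequentially by blast
  have "\<not> H \<subseteq> s ` {..<N}" using assms(2) finite_subset by blast
  then obtain n where "s n \<in> H" "\<not> n < N" using assms(3) by blast
  then show "\<exists>y. y \<in> H \<and> y \<in> T" using N by (meson not_less)
qed

text \<open>Every neighbourhood of \<open>x\<close> contains all of \<open>P\<close>, so any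
  enumeration of \<open>P\<close> converges to \<open>x\<close>.\<close>

lemma compact_preserving_finite_values_specialization:
  assumes "Hausdorff_space Y" "compact_preserving X Y f"
    and P: "countable P" "P \<subseteq> topspace X" "\<And>p. p \<in> P \<Longrightarrow> x \<in> X closure_of {p}"
    and W: "openin Y W" "f x \<in> W"
  shows "finite (f ` P - W)"
proof (cases "P = {}")
  case False
  have r: "range (from_nat_into P) = P"
    using False P(1) by (rule range_from_nat_into)
  obtain p where "p \<in> P" using False by blast
  then have "x \<in> topspace X" using P(3) in_closure_of by metis
  moreover have "from_nat_into P n \<in> U" if "openin X U" "x \<in> U" for n U
    using that P(3)[OF from_nat_into[OF False, of n]] unfolding in_closure_of by auto
  ultimately have "limitin X (from_nat_into P) x sequentially"
    unfolding limitin_sequentially by blast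
  then show ?thesis
    using compact_preserving_finite_values_outside[OF assms(1,2) _ _ W, of "from_nat_into P"]
      P(2) r by simp
qed simp

lemma compact_preserving_not_limit_of_SI_fibre:
  fixes a :: "nat \<Rightarrow> 'a"
  assumes X: "frechet_space X" and Y: "Hausdorff_space Y" and f: "compact_preserving X Y f"
    and a: "range a \<subseteq> {p \<in> SI X f. f p = y}" "limitin X a x sequentially"
  shows "f x = y"
proof (rule ccontr)
  assume ne: "f x \<noteq> y"
  have fY: "f p \<in> topspace Y" if "p \<in> topspace X" for p
    using f that by (auto simp: compact_preserving_def)
  have aSI: "a n \<in> SI X f" and fa: "f (a n) = y" for n using a(1) by auto
  have aX: "a n \<in> topspace X" for n using aSI by (auto simp: SI_def)
  have xX: "x \<in> topspace X" using a(2) by (simp add: limitin_def)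
  obtain V W where VW: "openin Y V" "openin Y W" "y \<in> V" "f x \<in> W" "disjnt V W"
    using Y ne fY[OF xX] fY[OF aX] fa unfolding Hausdorff_space_def by metis
  have "\<exists>s :: nat \<Rightarrow> 'a. range s \<subseteq> topspace X \<and> limitin X s (a n) sequentially \<and>
      infinite (f ` range s)" for n
    using aSI[of n] by (simp add: SI_def sequentially_infinite_at_def)
  then obtain s :: "nat \<Rightarrow> nat \<Rightarrow> 'a" where
    s: "\<And>n. range (s n) \<subseteq> topspace X" "\<And>n. limitin X (s n) (a n) sequentially"
       "\<And>n. infinite (f ` range (s n))"
    by metis
  define G where "G n = {p \<in> range (s n). f p \<in> V \<and> x \<notin> X closure_of {p}}" for n
  \<comment> \<open>The values of \<open>s n\<close> are those on \<open>G n\<close>, those on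
    \<open>P\<close> and those outside \<open>V\<close>. The last two kinds are finite in number,
    since values on \<open>P\<close> lie in \<open>V\<close> and so avoid \<open>W\<close>.\<close>
  have "infinite (f ` G n)" for n
  proof
    assume "finite (f ` G n)"
    define P where "P = {p \<in> range (s n). f p \<in> V \<and> x \<in> X closure_of {p}}"
    have "countable P" unfolding P_def by (rule countable_subset[of _ "range (s n)"]) auto
    moreover have "P \<subseteq> topspace X" using s(1) by (auto simp: P_def)
    ultimately have "finite (f ` P - W)"
      by (intro compact_preserving_finite_values_specialization[OF Y f _ _ _ VW(2,4)])
        (auto simp: P_def)
    moreover have "f ` P - W = f ` P" using VW(5) by (auto simp: P_def disjnt_iff)
    moreover have "finite (f ` range (s n) - V)"
      using compact_preserving_finite_values_outside[OF Y f s(1) s(2) VW(1)] VW(3) fa by simp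
    moreover have "f ` range (s n) \<subseteq> f ` G n \<union> f ` P \<union> (f ` range (s n) - V)"
      by (auto simp: G_def P_def)
    ultimately have "finite (f ` range (s n))"
      using \<open>finite (f ` G n)\<close> by (metis finite_Un finite_subset)
    then show False using s(3) by blast
  qed
  \<comment> \<open>One point is kept per value, so excluding finitely many values costs only
    finitely many points.\<close>
  moreover have "\<exists>H. H \<subseteq> G n \<and> inj_on f H \<and> f ` G n = f ` H" for n
    using subset_image_inj[of "f ` G n" f "G n"] by simp
  then obtain H where H: "\<And>n. H n \<subseteq> G n" "\<And>n. inj_on f (H n)" "\<And>n. f ` G n = f ` H n"
    by metis
  ultimately have infH: "infinite (H n)" for n by (metis finite_imageI)
  \<comment> \<open>The diagonal thinning: a value \<open>f (s i j)\<close> is excluded at every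
    stage \<open>n \<ge> max i j\<close>, so only finitely many stages contribute to its fibre in
    \<open>R\<close>.\<close>
  define F where "F n = (\<lambda>(i, j). f (s i j)) ` ({..n} \<times> {..n})" for n
  define R where "R = (\<Union>n. {p \<in> H n. f p \<notin> F n})"
  have RG: "\<exists>n. p \<in> G n" if "p \<in> R" for p using that H(1) by (auto simp: R_def)
  have "G n \<subseteq> topspace X" for n using s(1)[of n] by (auto simp: G_def)
  then have RX: "R \<subseteq> topspace X" using RG by blast
  have RW: "f p \<notin> W" and Rx: "x \<notin> X closure_of {p}" if "p \<in> R" for p
    using RG[OF that] VW(5) by (auto simp: G_def disjnt_iff)
  have fibre: "finite (f -` {v} \<inter> R)" if "v \<in> f ` R" for v
  proof -
    obtain p i where "v = f p" "p \<in> G i" using \<open>v \<in> f ` R\<close> RG by blast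
    then obtain j where v: "v = f (s i j)" by (auto simp: G_def)
    have "f -` {v} \<inter> R \<subseteq> (\<Union>n < max i j. f -` {v} \<inter> H n)"
    proof
      fix p assume "p \<in> f -` {v} \<inter> R"
      then obtain n where n: "p \<in> H n" "v \<notin> F n" "f p = v" by (auto simp: R_def)
      then have "\<not> (i \<le> n \<and> j \<le> n)" using v by (auto simp: F_def)
      then show "p \<in> (\<Union>n < max i j. f -` {v} \<inter> H n)" using n by auto
    qed
    moreover have "finite (f -` {v} \<inter> H n)" for n
      using H(2) by (simp add: finite_vimage_IntI)
    ultimately show ?thesis by (meson finite_UN_I finite_lessThan finite_subset)
  qed
  have "a n \<in> X closure_of R" for n
  proof -
    have "finite (f -` F n \<inter> H n)" using H(2) by (simp add: finite_vimage_IntI F_def)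
    then have "infinite (H n - f -` F n \<inter> H n)" using infH by simp
    moreover have "H n - f -` F n \<inter> H n \<subseteq> range (s n)" using H(1) by (auto simp: G_def)
    ultimately have "a n \<in> X closure_of (H n - f -` F n \<inter> H n)"
      using limitin_in_closure_of_infinite_subset[OF s(2)] by blast
    moreover have "H n - f -` F n \<inter> H n \<subseteq> R" by (auto simp: R_def)
    ultimately show ?thesis using closure_of_mono by blast
  qed
  then have "x \<in> X closure_of R"
    using limitin_closedin[OF a(2) closedin_closure_of always_eventually] by simp
  then obtain t :: "nat \<Rightarrow> 'a" where t: "range t \<subseteq> R" "limitin X t x sequentially"
    using X RX unfolding frechet_space_def by blast
  have "finite (f ` range t - W)"
    using t RX VW by (intro compact_preserving_finite_values_outside[OF Y f]) auto
  moreover have "f ` range t - W = f ` range t"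
    using t(1) RW by blast
  ultimately have "finite (f ` range t)" by simp
  moreover have "f ` range t \<subseteq> f ` R" using t(1) by blast
  ultimately have "finite (f -` (f ` range t) \<inter> R)"
    using fibre by (meson finite_finite_vimage_IntI subsetD)
  then have "finite (range t)" by (rule finite_subset[rotated]) (use t(1) in auto)
  moreover have "x \<in> X closure_of range t"
    using t(2) unfolding limitin_sequentially in_closure_of by blast
  \<comment> \<open>For \<open>id\<close> the fibres are single points, and \<open>G\<close>
    excludes every point whose closure contains \<open>x\<close>.\<close>
  ultimately obtain p where "p \<in> range t" "x \<in> X closure_of {q \<in> range t. q = p}"
    using closure_of_finite_image[of x X "range t" id] by auto
  moreover from this have "x \<in> X closure_of {p}"
    using closure_of_mono[of "{q \<in> range t. q = p}" "{p}" X] by blast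
  ultimately show False using t(1) Rx by blast
qed

theorem theorem3:
  fixes X :: "'a topology" and Y :: "'b topology" and f :: "'a \<Rightarrow> 'b"
  assumes "frechet_space X"
    and "Hausdorff_space Y"
    and "compact_preserving X Y f"
  shows "continuous_map (subtopology X (SI X f)) Y f"
  unfolding continuous_map_eq_image_closure_subset_alt
proof (intro allI impI Pi_I)
  fix S x
  assume "S \<subseteq> topspace (subtopology X (SI X f))" and "x \<in> subtopology X (SI X f) closure_of S"
  then have S: "S \<subseteq> SI X f" "S \<subseteq> topspace X" "x \<in> X closure_of S"
    using closure_of_subtopology_subset by force+
  show "f x \<in> Y closure_of f ` S"
  proof (rule ccontr)
    assume nc: "f x \<notin> Y closure_of f ` S"
    obtain a :: "nat \<Rightarrow> 'a" where a: "range a \<subseteq> S" "limitin X a x sequentially"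
      using assms(1) S unfolding frechet_space_def by blast
    have fS: "f ` S \<subseteq> topspace Y" and "f x \<in> topspace Y"
      using assms(3) S in_closure_of[of x X S] by (auto simp: compact_preserving_def)
    \<comment> \<open>The complement of the closure is a neighbourhood of \<open>f x\<close> that
      all values of \<open>a\<close> avoid, so these values are finite in number and the fibre of
      one of them accumulates at \<open>x\<close>.\<close>
    then have "finite (f ` range a - (topspace Y - Y closure_of f ` S))"
      using a S nc
      by (intro compact_preserving_finite_values_outside[OF assms(2,3)]) auto
    moreover have sub: "f ` S \<subseteq> Y closure_of f ` S" using fS closure_of_subset by blast
    then have "f ` range a - (topspace Y - Y closure_of f ` S) = f ` range a"
      using a(1) by blast
    ultimately have "finite (f ` range a)" by simp
    moreover have "x \<in> X closure_of range a"
      using a(2) unfolding limitin_sequentially in_closure_of by blast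
    ultimately obtain y where y: "y \<in> f ` range a" "x \<in> X closure_of {p \<in> range a. f p = y}"
      using closure_of_finite_image by metis
    moreover have "{p \<in> range a. f p = y} \<subseteq> topspace X" using a(1) S(2) by blast
    ultimately obtain b :: "nat \<Rightarrow> 'a" where
      b: "range b \<subseteq> {p \<in> range a. f p = y}" "limitin X b x sequentially"
      using assms(1) unfolding frechet_space_def by blast
    have "range b \<subseteq> {p \<in> SI X f. f p = y}" using a(1) S(1) b(1) by blast
    then have "f x = y"
      using compact_preserving_not_limit_of_SI_fibre[OF assms] b(2) by blast
    then show False using y(1) a(1) sub nc by blast
  qed
qed

end
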